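(* There is an absolute constant $c>0$ such that for every polygonal domain $P$ in the plane, every $0<\alpha<1$ and every point $g\in P$, the $\alpha$-robust visibility region $\mathrm{Vis}_\alpha(g)$ is star-shaped and $c\alpha$-fat (i.e. $O(\alpha)$-fat).
   Context: A polygonal domain $P$ is a (closed) polygon in the plane, possibly with holes. Two points of $P$ see each other if the line segment between them is contained in $P$. $D(p,r)$ denotes the disk of radius $r$ centered at $p$. A point $g\in P$ $\alpha$-robustly guards a point $p\in P$ if $p$ sees every point of $D(g,\alpha\|p-g\|)$. $\mathrm{Vis}_\alpha(g)$ is the set of points of $P$ that are $\alpha$-robustly guarded by $g$. Fatness: for a planar region $F$, a point $p\in F$ and a radius $r$, let $C(p,r)$ be the connected component of $D(p,r)\cap F$ containing $p$. $F$ is $\gamma$-fat if for every $p\in F$ and every $r$ such that $D(p,r)$ does not fully contain $F$, the area of $C(p,r)$ is at least $\gamma\cdot\pi r^2$. *)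

theory Defs
  imports "HOL-Analysis.Analysis"
begin

definition polygon_edge :: "(real^2) list \<Rightarrow> nat \<Rightarrow> (real^2) set" where
  "polygon_edge vs i = closed_segment (vs ! i) (vs ! (Suc i mod length vs))"

text \<open>The intersection condition makes consecutive edges meet only in their common
  endpoint and non-consecutive edges disjoint.\<close>

definition simple_polygon :: "(real^2) list \<Rightarrow> bool" where
  "simple_polygon vs \<longleftrightarrow> 3 \<le> length vs \<and> distinct vs \<and>
     (\<forall>i j. i < j \<and> j < length vs \<longrightarrow>
        polygon_edge vs i \<inter> polygon_edge vs j =
          {vs ! i, vs ! (Suc i mod length vs)} \<inter> {vs ! j, vs ! (Suc j mod length vs)})"

definition polygon_boundary :: "(real^2) list \<Rightarrow> (real^2) set" where
  "polygon_boundary vs = (\<Union>i<length vs. polygon_edge vs i)"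

definition polygon_region :: "(real^2) list \<Rightarrow> (real^2) set" where
  "polygon_region vs = polygon_boundary vs \<union> inside (polygon_boundary vs)"

text \<open>Only the open interiors of the holes are removed, so that the domain is closed and
  contains the boundaries of its holes.\<close>

definition polygonal_domain :: "(real^2) set \<Rightarrow> bool" where
  "polygonal_domain P \<longleftrightarrow>
     (\<exists>outer holes.
        simple_polygon outer \<and>
        (\<forall>h\<in>set holes. simple_polygon h \<and>
           polygon_region h \<subseteq> inside (polygon_boundary outer)) \<and>
        (\<forall>i j. i < j \<and> j < length holes \<longrightarrow>
           polygon_region (holes ! i) \<inter> polygon_region (holes ! j) = {}) \<and>
        P = polygon_region outer - (\<Union>h\<in>set holes. inside (polygon_boundary h)))"

definition sees :: "(real^2) set \<Rightarrow> real^2 \<Rightarrow> real^2 \<Rightarrow> bool" where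
  "sees P x y \<longleftrightarrow> closed_segment x y \<subseteq> P"

definition robustly_guards :: "(real^2) set \<Rightarrow> real \<Rightarrow> real^2 \<Rightarrow> real^2 \<Rightarrow> bool" where
  "robustly_guards P \<alpha> g p \<longleftrightarrow> (\<forall>q \<in> cball g (\<alpha> * norm (p - g)). sees P p q)"

definition robust_vis :: "(real^2) set \<Rightarrow> real \<Rightarrow> real^2 \<Rightarrow> (real^2) set" where
  "robust_vis P \<alpha> g = {p \<in> P. robustly_guards P \<alpha> g p}"

definition fat :: "real \<Rightarrow> (real^2) set \<Rightarrow> bool" where
  "fat \<gamma> F \<longleftrightarrow>
     (\<forall>p\<in>F. \<forall>r>0. \<not> F \<subseteq> cball p r \<longrightarrow>
        \<gamma> * (pi * r\<^sup>2) \<le> measure lebesgue (connected_component_set (cball p r \<inter> F) p))"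

end

theory Submission
  imports Defs
begin

text \<open>If \<open>x\<close> is robustly guarded by \<open>g\<close> and \<open>d = \<parallel>x - g\<parallel>\<close>, the ice-cream cone
  \<open>K = conv ({x} \<union> D(g, \<alpha>d))\<close> lies in \<open>P\<close>. Since \<open>K \<subseteq> D(g, d)\<close>, for every \<open>y \<in> K\<close> the disk
  \<open>D(g, \<alpha>\<parallel>y - g\<parallel>)\<close> is contained in \<open>K\<close>, so by convexity \<open>K\<close> consists of robustly guarded points.
  This gives star-shapedness about \<open>g\<close>. For fatness at \<open>p\<close> with radius \<open>r\<close>: if \<open>r \<le> 2\<parallel>p - g\<parallel>\<close>,
  shrinking the cone of \<open>p\<close> towards its apex yields a triangle of area \<open>\<alpha>r\<^sup>2/4\<close> inside \<open>D(p,r)\<close>.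
  Otherwise some guarded point is farther than \<open>r/2\<close> from \<open>g\<close>; moving it towards \<open>g\<close> to distance
  exactly \<open>r/2\<close>, its cone lies in \<open>D(p,r)\<close>, again contains a triangle of area \<open>\<alpha>r\<^sup>2/4\<close>, and is
  joined to \<open>p\<close> through \<open>g\<close>.\<close>

lemma closed_polygon_boundary: "closed (polygon_boundary vs)"
  unfolding polygon_boundary_def polygon_edge_def by (intro closed_UN) auto

lemma closed_Un_inside:
  fixes S :: "'a::real_normed_vector set"
  assumes "closed S"
  shows "closed (S \<union> inside S)"
proof -
  have "S \<union> inside S = - outside S"
    by (rule union_with_inside)
  then show ?thesis
    by (simp add: assms open_outside closed_Compl)
qed

lemma closed_polygonal_domain: "polygonal_domain P \<Longrightarrow> closed P"
  unfolding polygonal_domain_def polygon_region_def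
  by (auto intro!: closed_Un_inside closed_polygon_boundary open_inside)

text \<open>Used to make the components in the fatness condition compact, hence measurable, so that
  the area of a triangle inside one bounds its area from below. Parametrising the varying disk by
  the fixed unit disk writes the region as an intersection of preimages of \<open>P\<close> under
  continuous maps.\<close>

lemma closed_robust_vis:
  assumes "closed P" "0 \<le> \<alpha>"
  shows "closed (robust_vis P \<alpha> g)"
proof -
  define f where "f = (\<lambda>w t x. (1 - t) *\<^sub>R x + t *\<^sub>R (g + (\<alpha> * norm (x - g)) *\<^sub>R w))"
  have ball: "cball g (\<alpha> * norm (x - g)) = (\<lambda>w. g + (\<alpha> * norm (x - g)) *\<^sub>R w) ` cball 0 1" for x
  proof (cases "\<alpha> * norm (x - g) = 0")
    case True
    then show ?thesis
      unfolding True by (simp add: image_constant_conv)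
  next
    case False
    then have "cball (0::real^2) (\<alpha> * norm (x - g)) =
        (\<lambda>w. (\<alpha> * norm (x - g)) *\<^sub>R w) ` cball 0 1"
      using cball_scale[OF False, of "0::real^2" 1] assms(2) by (simp add: abs_mult)
    then show ?thesis
      using cball_translation[of g 0 "\<alpha> * norm (x - g)"] by (simp add: image_image)
  qed
  have "robust_vis P \<alpha> g = P \<inter> (\<Inter>w\<in>cball 0 1. \<Inter>t\<in>{0..1}. f w t -` P)"
    unfolding robust_vis_def robustly_guards_def sees_def ball f_def
    by (fastforce simp: closed_segment_def)
  moreover have "closed (f w t -` P)" for w t
    unfolding f_def by (intro continuous_closed_vimage assms continuous_intros)
  ultimately show ?thesis
    using assms by (auto intro!: closed_Int closed_INT)
qed

lemma cone_subset_cball: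
  fixes x g :: "'a::real_normed_vector"
  assumes "0 \<le> \<alpha>" "\<alpha> \<le> 1"
  shows "convex hull (insert x (cball g (\<alpha> * norm (x - g)))) \<subseteq> cball g (norm (x - g))"
proof (intro hull_minimal insert_subsetI subset_cball)
  show "x \<in> cball g (norm (x - g))"
    by (simp add: dist_norm norm_minus_commute)
qed (use assms in \<open>simp_all add: mult_left_le_one_le\<close>)

lemma cone_subset_robust_vis:
  assumes x: "x \<in> robust_vis P \<alpha> g" and \<alpha>: "0 < \<alpha>" "\<alpha> \<le> 1"
  shows "convex hull (insert x (cball g (\<alpha> * norm (x - g)))) \<subseteq> robust_vis P \<alpha> g" (is "?K \<subseteq> _")
proof
  have K_cball: "?K \<subseteq> cball g (norm (x - g))"
    using \<alpha> by (intro cone_subset_cball) auto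
  \<comment> \<open>As the disk is convex, the cone is the union of the segments from
    \<open>x\<close> to points of the disk, and \<open>x\<close> sees all of these points.\<close>
  have K_P: "?K \<subseteq> P"
    using x \<alpha> by (auto simp: convex_hull_insert_segments
        convex_hull_eq[THEN iffD2] robust_vis_def robustly_guards_def sees_def)
  fix y assume y: "y \<in> ?K"
  then have "norm (y - g) \<le> norm (x - g)"
    using K_cball by (auto simp: dist_norm norm_minus_commute)
  then have "cball g (\<alpha> * norm (y - g)) \<subseteq> cball g (\<alpha> * norm (x - g))"
    using \<alpha> by (intro subset_cball mult_left_mono) auto
  also have "\<dots> \<subseteq> ?K"
    by (auto intro: hull_inc)
  finally have "closed_segment y q \<subseteq> ?K" if "q \<in> cball g (\<alpha> * norm (y - g))" for q
    using y that by (intro closed_segment_subset convex_convex_hull) auto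
  with K_P have "closed_segment y q \<subseteq> P" if "q \<in> cball g (\<alpha> * norm (y - g))" for q
    using that by blast
  with K_P y show "y \<in> robust_vis P \<alpha> g"
    by (auto simp: robust_vis_def robustly_guards_def sees_def)
qed

lemma segment_subset_robust_vis:
  assumes "x \<in> robust_vis P \<alpha> g" "0 < \<alpha>" "\<alpha> \<le> 1"
  shows "closed_segment g x \<subseteq> robust_vis P \<alpha> g"
proof -
  have "closed_segment g x \<subseteq> convex hull (insert x (cball g (\<alpha> * norm (x - g))))"
    using assms by (intro closed_segment_subset convex_convex_hull hull_inc) auto
  then show ?thesis
    using cone_subset_robust_vis[OF assms] by blast
qed

lemma starlike_robust_vis:
  assumes "g \<in> P" "0 < \<alpha>" "\<alpha> \<le> 1"
  shows "starlike (robust_vis P \<alpha> g)"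
proof -
  \<comment> \<open>For the point \<open>g\<close> itself the disk degenerates to
    \<open>{g}\<close>.\<close>
  have "g \<in> robust_vis P \<alpha> g"
    using assms by (simp add: robust_vis_def robustly_guards_def sees_def)
  then show ?thesis
    unfolding starlike_def using assms segment_subset_robust_vis by blast
qed

text \<open>The cone contains the triangle with apex \<open>x\<close> and base a diameter of the
  disk perpendicular to the axis: base 2 \<alpha> d, height d, area \<alpha> d^2, where d is the
  distance from \<open>x\<close> to \<open>g\<close>. A homothety about \<open>x\<close> of ratio
  \<open>s\<close> scales the area by s^2.\<close>

lemma triangle_in_robust_vis:
  assumes x: "x \<in> robust_vis P \<alpha> g" and \<alpha>: "0 < \<alpha>" "\<alpha> \<le> 1" and s: "0 \<le> s" "s \<le> 1"
  obtains T where "compact T" "convex T" "x \<in> T" "T \<subseteq> robust_vis P \<alpha> g"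
    "T \<subseteq> cball g (norm (x - g))" "T \<subseteq> cball x (2 * s * norm (x - g))"
    "measure lebesgue T = s\<^sup>2 * (\<alpha> * (norm (x - g))\<^sup>2)"
proof -
  define v where "v = x - g"
  \<comment> \<open>\<open>u\<close> is \<open>v\<close> turned by a right angle; \<open>a\<close>
    and \<open>b\<close> are the images under the homothety of the endpoints
    \<open>g + \<alpha> *\<^sub>R u\<close> and \<open>g - \<alpha> *\<^sub>R u\<close> of the
    diameter.\<close>
  define u :: "real^2" where "u = vector [- v $ 2, v $ 1]"
  define a where "a = x + s *\<^sub>R (\<alpha> *\<^sub>R u - v)"
  define b where "b = x + s *\<^sub>R (- (\<alpha> *\<^sub>R u) - v)"
  define T where "T = convex hull {x, a, b}"
  define K where "K = convex hull (insert x (cball g (\<alpha> * norm (x - g))))"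
  have norm_u: "norm u = norm v"
    by (simp add: u_def norm_vec_def L2_set_def sum_2 add.commute)
  have "g + \<alpha> *\<^sub>R u \<in> K" "g - \<alpha> *\<^sub>R u \<in> K" "x \<in> K"
    using \<alpha> by (auto simp: K_def dist_norm norm_u v_def intro!: hull_inc)
  moreover have "a = (1 - s) *\<^sub>R x + s *\<^sub>R (g + \<alpha> *\<^sub>R u)" "b = (1 - s) *\<^sub>R x + s *\<^sub>R (g - \<alpha> *\<^sub>R u)"
    by (simp_all add: a_def b_def v_def algebra_simps)
  moreover have "convex K"
    by (simp add: K_def)
  ultimately have "{x, a, b} \<subseteq> K"
    using s by (simp add: convexD)
  then have TK: "T \<subseteq> K"
    unfolding T_def using \<open>convex K\<close> by (rule hull_minimal)
  also have "K \<subseteq> robust_vis P \<alpha> g"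
    unfolding K_def using x \<alpha> by (rule cone_subset_robust_vis)
  finally have T_vis: "T \<subseteq> robust_vis P \<alpha> g" .
  have "K \<subseteq> cball g (norm (x - g))"
    unfolding K_def using \<alpha> by (intro cone_subset_cball) auto
  with TK have T_g: "T \<subseteq> cball g (norm (x - g))"
    by simp
  have "norm (\<alpha> *\<^sub>R u - v) \<le> 2 * norm v" "norm (- (\<alpha> *\<^sub>R u) - v) \<le> 2 * norm v"
    using norm_triangle_ineq4[of "\<alpha> *\<^sub>R u" v] norm_triangle_ineq4[of "- (\<alpha> *\<^sub>R u)" v] \<alpha>
      mult_left_le_one_le[of "norm v" \<alpha>] by (simp_all add: norm_u)
  then have "s * norm (\<alpha> *\<^sub>R u - v) \<le> s * (2 * norm v)"
    "s * norm (- (\<alpha> *\<^sub>R u) - v) \<le> s * (2 * norm v)"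
    using s by (simp_all only: mult_left_mono)
  then have "T \<subseteq> cball x (2 * s * norm (x - g))"
    unfolding T_def using s
    by (intro hull_minimal) (auto simp: a_def b_def dist_norm v_def mult.assoc mult.left_commute)
  moreover have "measure lebesgue T = s\<^sup>2 * (\<alpha> * (norm (x - g))\<^sup>2)"
  proof -
    have norm2: "(norm v)\<^sup>2 = (v $ 1)\<^sup>2 + (v $ 2)\<^sup>2"
      by (simp add: norm_vec_def L2_set_def sum_2)
    have "T \<in> sets lborel"
      by (simp add: T_def borel_compact compact_convex_hull)
    then have "measure lebesgue T = measure lborel T"
      by (rule measure_completion)
    also have "\<dots> = \<bar>2 * (s\<^sup>2 * (\<alpha> * (norm v)\<^sup>2))\<bar> / 2"
    proof -
      \<comment> \<open>Twice the signed area, the cross product of the two edges at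
        \<open>x\<close>.\<close>
      have "(b $ 1 - x $ 1) * (a $ 2 - x $ 2) - (a $ 1 - x $ 1) * (b $ 2 - x $ 2) =
          - (2 * (s\<^sup>2 * (\<alpha> * (norm v)\<^sup>2)))"
        unfolding norm2 a_def b_def u_def by simp algebra
      then show ?thesis
        unfolding T_def content_triangle by simp
    qed
    finally have "measure lebesgue T = \<bar>2 * (s\<^sup>2 * (\<alpha> * (norm v)\<^sup>2))\<bar> / 2" .
    then show ?thesis
      using \<alpha> by (simp add: abs_mult v_def)
  qed
  ultimately show thesis
    using T_vis T_g by (intro that[of T]) (simp_all add: T_def compact_convex_hull hull_inc)
qed

lemma fat_robust_vis:
  assumes P: "closed P" and \<alpha>: "0 < \<alpha>" "\<alpha> \<le> 1"
  shows "fat (\<alpha> / (4 * pi)) (robust_vis P \<alpha> g)"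
  unfolding fat_def
proof (intro ballI allI impI)
  let ?V = "robust_vis P \<alpha> g"
  fix p r
  assume p: "p \<in> ?V" and "0 < r" and V: "\<not> ?V \<subseteq> cball p r"
  let ?C = "connected_component_set (cball p r \<inter> ?V) p"
  define d where "d = norm (p - g)"
  have "closed ?C"
    using P \<alpha> by (intro closed_connected_component closed_Int closed_robust_vis) auto
  moreover have "bounded ?C"
    by (meson bounded_cball bounded_subset connected_component_subset le_inf_iff)
  ultimately have C: "?C \<in> lmeasurable"
    by (simp add: compact_eq_bounded_closed lmeasurable_compact)
  have "\<exists>T. compact T \<and> T \<subseteq> ?C \<and> measure lebesgue T = \<alpha> * r\<^sup>2 / 4"
  proof (cases "r \<le> 2 * d")
    case True
    with \<open>0 < r\<close> have "d > 0"
      by simp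
    \<comment> \<open>The ratio r / (2d) makes the radius bound 2sd equal to \<open>r\<close>; the
      case assumption says that it is at most 1.\<close>
    obtain T where T: "compact T" "convex T" "p \<in> T" "T \<subseteq> ?V" "T \<subseteq> cball p (2 * (r / (2 * d)) * d)"
      "measure lebesgue T = (r / (2 * d))\<^sup>2 * (\<alpha> * d\<^sup>2)"
    proof (rule triangle_in_robust_vis[OF p \<alpha>, of "r / (2 * d)"])
      show "0 \<le> r / (2 * d)" "r / (2 * d) \<le> 1"
        using True \<open>0 < r\<close> \<open>d > 0\<close> by simp_all
    qed (simp add: d_def)
    then have "T \<subseteq> ?C"
      using \<open>d > 0\<close> by (intro connected_component_maximal convex_connected) auto
    with T \<open>d > 0\<close> show ?thesis
      by (intro exI[of _ T]) (simp add: field_simps power2_eq_square)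
  next
    case False
    from V obtain y where y: "y \<in> ?V" "r < norm (y - p)"
      by (auto simp: subset_iff dist_norm norm_minus_commute not_le)
    then have ry: "r / 2 < norm (y - g)"
      using norm_triangle_ineq4[of "y - g" "p - g"] False by (simp add: d_def)
    \<comment> \<open>Distance r/2 puts the cone of \<open>x\<close> in
      \<open>cball g (r / 2)\<close>, which lies in \<open>cball p r\<close> because d < r/2. The
      full triangle, with ratio 1, then has area \<alpha> r^2 / 4.\<close>
    define x where "x = g + (r / (2 * norm (y - g))) *\<^sub>R (y - g)"
    have yg: "0 < norm (y - g)"
      using ry \<open>0 < r\<close> by linarith
    then have xg: "norm (x - g) = r / 2"
      using \<open>0 < r\<close> by (simp add: x_def)
    have "x \<in> closed_segment g y"
    proof -
      have "r / (2 * norm (y - g)) \<le> 1"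
        using ry yg by (simp add: divide_simps del: zero_less_norm_iff)
      then show ?thesis
        unfolding in_segment x_def using \<open>0 < r\<close>
        by (intro exI[of _ "r / (2 * norm (y - g))"]) (simp add: algebra_simps)
    qed
    then have x: "x \<in> ?V"
      using segment_subset_robust_vis[OF y(1) \<alpha>] by blast
    obtain T where T: "compact T" "convex T" "x \<in> T" "T \<subseteq> ?V" "T \<subseteq> cball g (r / 2)"
      "measure lebesgue T = \<alpha> * (r / 2)\<^sup>2"
      by (rule triangle_in_robust_vis[OF x \<alpha>, of 1]) (simp_all add: xg)
    have g_r: "cball g (r / 2) \<subseteq> cball p r"
      using False by (intro cball_subset_cball_iff[THEN iffD2]) (auto simp: d_def dist_norm norm_minus_commute)
    \<comment> \<open>\<open>T\<close> need not contain \<open>p\<close>, so the path from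
      \<open>p\<close> via \<open>g\<close> to \<open>x\<close> places it in the component of
      \<open>p\<close>.\<close>
    have "connected (closed_segment g p \<union> (closed_segment g x \<union> T))"
      using T by (intro connected_Un[OF _ connected_Un]) (auto intro: convex_connected)
    moreover have "closed_segment g p \<union> (closed_segment g x \<union> T) \<subseteq> cball p r \<inter> ?V"
    proof -
      have "closed_segment g p \<subseteq> cball p r" "closed_segment g x \<subseteq> cball p r"
        using subsetD[OF g_r, of g] subsetD[OF g_r, of x] xg \<open>0 < r\<close>
        by (intro closed_segment_subset; simp add: dist_norm norm_minus_commute)+
      then show ?thesis
        using T g_r segment_subset_robust_vis[OF x \<alpha>] segment_subset_robust_vis[OF p \<alpha>] by blast
    qed
    ultimately have "closed_segment g p \<union> (closed_segment g x \<union> T) \<subseteq> ?C"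
      by (intro connected_component_maximal) auto
    with T show ?thesis
      by (intro exI[of _ T]) (auto simp: power2_eq_square)
  qed
  then obtain T where T: "compact T" "T \<subseteq> ?C" "measure lebesgue T = \<alpha> * r\<^sup>2 / 4"
    by blast
  then have "\<alpha> * r\<^sup>2 / 4 \<le> measure lebesgue ?C"
    using measure_mono_fmeasurable[OF T(2) _ C] fmeasurableD[OF lmeasurable_compact[OF T(1)]] by simp
  then show "\<alpha> / (4 * pi) * (pi * r\<^sup>2) \<le> measure lebesgue ?C"
    by simp
qed

theorem lemma6:
  "\<exists>c::real. c > 0 \<and>
     (\<forall>P \<alpha> g. polygonal_domain P \<and> 0 < \<alpha> \<and> \<alpha> < 1 \<and> g \<in> P \<longrightarrow>
        starlike (robust_vis P \<alpha> g) \<and> fat (c * \<alpha>) (robust_vis P \<alpha> g))"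
  \<comment> \<open>With this constant, c \<alpha> times the disk area pi r^2 is exactly the
    triangle area \<alpha> r^2 / 4.\<close>
  by (intro exI[of _ "1 / (4 * pi)"] conjI allI impI)
    (auto intro!: starlike_robust_vis fat_robust_vis closed_polygonal_domain)

end
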